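(* Let $P,Q$ be two positively homogeneous functions of degree one in $y$ satisfying $$Q_{;i}=(PQ)_{.i}$$ with respect to a spray $\mathbf{G}$. Then $Q$ is a Hamel function of $\mathbf{G}$. Further, if $\mathbf{G}=0$ (that is, $G^i=0$ on $\mathbb{R}^n$) and $P$ is a Funk function of $\mathbf{G}$, then in a neighborhood of $0\in\mathbb{R}^n$, $Q$ can be expressed as $$Q(x,y)=\psi\big(y+P(x,y)x\big)\,\big(1+P_{y^m}(x,y)x^m\big),$$ where $\psi$ is defined by $\psi(y):=Q(0,y)$.
   Context: A spray on a manifold $M$ is a smooth vector field on a conical region of $TM\setminus\{0\}$ (an open set closed under $y\mapsto\lambda y$, $\lambda>0$), locally $\mathbf{G}=y^i\frac{\partial}{\partial x^i}-2G^i\frac{\partial}{\partial y^i}$ with $G^i$ positively homogeneous of degree two in $y$. Put $\partial_k=\partial/\partial x^k$, $\dot\partial_k=\partial/\partial y^k$, $G^r_i=\dot\partial_iG^r$, $G^r_{ij}=\dot\partial_j\dot\partial_iG^r$, $\delta_i=\partial_i-G^r_i\dot\partial_r$. For a function $f$: $f_{.i}=\dot\partial_if$, $f_{;i}=\delta_if$, $f_{.i;j}=\delta_jf_{.i}-f_{.r}G^r_{ij}$, $f_{.i;0}=f_{.i;j}y^j$. A Hamel function (resp. Funk function) of $\mathbf{G}$ is a function $P$, positively homogeneous of degree one in $y$, with $P_{;k}=P_{.k;0}$ (resp. $P_{;k}=PP_{.k}$). For $G^i=0$, $f_{;i}=f_{x^i}$, so the hypothesis reads $Q_{x^i}=(PQ)_{y^i}$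 and $P$ being Funk means $P_{x^k}=PP_{y^k}$. *)

theory Defs
  imports "HOL-Analysis.Analysis"
begin

text \<open>Smoothness on an open set of a Euclidean space: all iterated directional derivatives
  exist and are differentiable.\<close>

primrec Ck_on ::
  "nat \<Rightarrow> 'a set \<Rightarrow> ('a::euclidean_space \<Rightarrow> 'b::real_normed_vector) \<Rightarrow> bool" where
  "Ck_on 0 D f \<longleftrightarrow> continuous_on D f"
| "Ck_on (Suc k) D f \<longleftrightarrow>
     (\<forall>x\<in>D. f differentiable (at x)) \<and> (\<forall>v. Ck_on k D (\<lambda>x. frechet_derivative f (at x) v))"

definition smooth_on :: "'a set \<Rightarrow> ('a::euclidean_space \<Rightarrow> 'b::real_normed_vector) \<Rightarrow> bool" where
  "smooth_on D f \<longleftrightarrow> (\<forall>k. Ck_on k D f)"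

section \<open>Manifolds and tangent bundles\<close>

type_synonym ('m, 'e) chart = "'m set \<times> ('m \<Rightarrow> 'e)"

definition transition :: "('m, 'e) chart \<Rightarrow> ('m, 'e) chart \<Rightarrow> 'e \<Rightarrow> 'e" where
  "transition c d = snd d \<circ> inv_into (fst c) (snd c)"

definition coord_rep :: "('m, 'e) chart \<Rightarrow> ('m \<Rightarrow> 'b) \<Rightarrow> 'e \<Rightarrow> 'b" where
  "coord_rep c f = f \<circ> inv_into (fst c) (snd c)"

definition smooth_manifold :: "'m topology \<Rightarrow> ('m, 'e::euclidean_space) chart set \<Rightarrow> bool" where
  "smooth_manifold X A \<longleftrightarrow>
     Hausdorff_space X \<and> second_countable X \<and>
     \<Union> (fst ` A) = topspace X \<and>
     (\<forall>c\<in>A. openin X (fst c) \<and> open (snd c ` fst c) \<and>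
        homeomorphic_map (subtopology X (fst c)) (top_of_set (snd c ` fst c)) (snd c)) \<and>
     (\<forall>c\<in>A. \<forall>d\<in>A. smooth_on (snd c ` (fst c \<inter> fst d)) (transition c d))"

text \<open>A tangent vector at \<open>p\<close> is the family of its components in the charts around \<open>p\<close>, related
  by the Jacobians of the transition maps. At the charts that do not contain \<open>p\<close> the family is
  set to zero, so that it is determined by its components in any one chart around \<open>p\<close>.\<close>

type_synonym ('m, 'e) tangent = "('m, 'e) chart \<Rightarrow> 'e"

definition tangent_space ::
  "('m, 'e::euclidean_space) chart set \<Rightarrow> 'm \<Rightarrow> ('m, 'e) tangent set" where
  "tangent_space A p = {v.
     (\<forall>c\<in>A. \<forall>d\<in>A. p \<in> fst c \<and> p \<in> fst d \<longrightarrow>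
        v d = frechet_derivative (transition c d) (at (snd c p)) (v c)) \<and>
     (\<forall>c. \<not> (c \<in> A \<and> p \<in> fst c) \<longrightarrow> v c = 0)}"

type_synonym ('m, 'e) tangent_point = "'m \<times> ('m, 'e) tangent"

definition tangent_bundle ::
  "('m, 'e::euclidean_space) chart set \<Rightarrow> ('m, 'e) tangent_point set" where
  "tangent_bundle A = {(p, v). p \<in> \<Union> (fst ` A) \<and> v \<in> tangent_space A p}"

definition slit_tangent_bundle ::
  "('m, 'e::euclidean_space) chart set \<Rightarrow> ('m, 'e) tangent_point set" where
  "slit_tangent_bundle A = {(p, v) \<in> tangent_bundle A. v \<noteq> (\<lambda>_. 0)}"

text \<open>The chart \<open>(x, y)\<close> of the tangent bundle induced by a chart \<open>x\<close> of the manifold.\<close>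

definition induced_chart ::
  "('m, 'e::euclidean_space) chart set \<Rightarrow> ('m, 'e) chart
     \<Rightarrow> (('m, 'e) tangent_point, 'e \<times> 'e) chart" where
  "induced_chart A c = ({(p, v) \<in> tangent_bundle A. p \<in> fst c}, \<lambda>(p, v). (snd c p, v c))"

definition chart_image :: "('m, 'e) chart \<Rightarrow> 'm set \<Rightarrow> 'e set" where
  "chart_image c W = snd c ` (W \<inter> fst c)"

definition smooth_function ::
  "('m, 'e::euclidean_space) chart set \<Rightarrow> 'm set \<Rightarrow> ('m \<Rightarrow> real) \<Rightarrow> bool" where
  "smooth_function A W f \<longleftrightarrow> (\<forall>c\<in>A. smooth_on (chart_image c W) (coord_rep c f))"

definition smooth_vector_field ::
  "('m, 'e::euclidean_space) chart set \<Rightarrow> 'm set \<Rightarrow> ('m \<Rightarrow> ('m, 'e) tangent) \<Rightarrow> bool" where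
  "smooth_vector_field A W V \<longleftrightarrow>
     (\<forall>z\<in>W. V z \<in> tangent_space A z) \<and>
     (\<forall>c\<in>A. smooth_on (chart_image c W) (coord_rep c (\<lambda>z. V z c)))"

section \<open>Sprays\<close>

definition scale_tangent :: "real \<Rightarrow> ('m, 'e::real_vector) tangent_point \<Rightarrow> ('m, 'e) tangent_point"
  where "scale_tangent l z = (fst z, \<lambda>c. l *\<^sub>R snd z c)"

definition conical_region ::
  "('m, 'e::euclidean_space) chart set \<Rightarrow> ('m, 'e) tangent_point set \<Rightarrow> bool" where
  "conical_region A C \<longleftrightarrow>
     C \<subseteq> slit_tangent_bundle A \<and>
     (\<forall>c\<in>A. open (chart_image (induced_chart A c) C)) \<and>
     (\<forall>z\<in>C. \<forall>l>0. scale_tangent l z \<in> C)"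

definition pos_homogeneous ::
  "('m, 'e::euclidean_space) tangent_point set \<Rightarrow> (('m, 'e) tangent_point \<Rightarrow> real) \<Rightarrow> bool" where
  "pos_homogeneous C f \<longleftrightarrow> (\<forall>z\<in>C. \<forall>l>0. f (scale_tangent l z) = l * f z)"

type_synonym ('m, 'e) second_order_field =
  "('m, 'e) tangent_point \<Rightarrow> (('m, 'e) tangent_point, 'e \<times> 'e) tangent"

text \<open>The components of a spray in an induced chart are \<open>(y, -2 G)\<close>; the following extracts \<open>G\<close>.\<close>

definition spray_coeff ::
  "('m, 'e::euclidean_space) chart set \<Rightarrow> ('m, 'e) second_order_field \<Rightarrow> ('m, 'e) chart
     \<Rightarrow> 'e \<times> 'e \<Rightarrow> 'e" where
  "spray_coeff A S c =
     coord_rep (induced_chart A c) (\<lambda>z. (- 1 / 2) *\<^sub>R snd (S z (induced_chart A c)))"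

definition spray ::
  "('m, 'e::euclidean_space) chart set \<Rightarrow> ('m, 'e) tangent_point set
     \<Rightarrow> ('m, 'e) second_order_field \<Rightarrow> bool" where
  "spray A C S \<longleftrightarrow>
     conical_region A C \<and>
     smooth_vector_field (induced_chart A ` A) C S \<and>
     (\<forall>c\<in>A. \<forall>z \<in> C \<inter> fst (induced_chart A c). fst (S z (induced_chart A c)) = snd z c) \<and>
     (\<forall>c\<in>A. \<forall>(x, y) \<in> chart_image (induced_chart A c) C. \<forall>l>0.
        spray_coeff A S c (x, l *\<^sub>R y) = l\<^sup>2 *\<^sub>R spray_coeff A S c (x, y))"

section \<open>Derivatives with respect to a spray in local coordinates\<close>

definition pdx :: "'n \<Rightarrow> ((real^'n) \<times> (real^'n) \<Rightarrow> real) \<Rightarrow> (real^'n) \<times> (real^'n) \<Rightarrow> real" where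
  "pdx k f z = frechet_derivative f (at z) (axis k 1, 0)"

definition pdy :: "'n \<Rightarrow> ((real^'n) \<times> (real^'n) \<Rightarrow> real) \<Rightarrow> (real^'n) \<times> (real^'n) \<Rightarrow> real" where
  "pdy k f z = frechet_derivative f (at z) (0, axis k 1)"

text \<open>\<open>conn1 G r i\<close> and \<open>conn2 G r i j\<close> are \<open>G\<close> with upper index \<open>r\<close> and lower indices
  \<open>i\<close> and \<open>i, j\<close>.\<close>

definition conn1 ::
  "((real^'n) \<times> (real^'n) \<Rightarrow> real^'n) \<Rightarrow> 'n \<Rightarrow> 'n \<Rightarrow> (real^'n) \<times> (real^'n) \<Rightarrow> real" where
  "conn1 G r i = pdy i (\<lambda>z. G z $ r)"

definition conn2 ::
  "((real^'n) \<times> (real^'n) \<Rightarrow> real^'n) \<Rightarrow> 'n \<Rightarrow> 'n \<Rightarrow> 'n \<Rightarrow> (real^'n) \<times> (real^'n) \<Rightarrow> real" where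
  "conn2 G r i j = pdy j (conn1 G r i)"

text \<open>\<open>hder\<close> is \<open>f\<^sub>;\<^sub>i\<close>, \<open>vhder\<close> is \<open>f\<^sub>.\<^sub>i\<^sub>;\<^sub>j\<close> and \<open>vhder0\<close> is \<open>f\<^sub>.\<^sub>i\<^sub>;\<^sub>0\<close>.\<close>

definition hder ::
  "((real^'n) \<times> (real^'n) \<Rightarrow> real^'n) \<Rightarrow> 'n \<Rightarrow> ((real^'n) \<times> (real^'n) \<Rightarrow> real)
     \<Rightarrow> (real^'n) \<times> (real^'n) \<Rightarrow> real" where
  "hder G i f z = pdx i f z - (\<Sum>r\<in>UNIV. conn1 G r i z * pdy r f z)"

definition vhder ::
  "((real^'n) \<times> (real^'n) \<Rightarrow> real^'n) \<Rightarrow> 'n \<Rightarrow> 'n \<Rightarrow> ((real^'n) \<times> (real^'n) \<Rightarrow> real)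
     \<Rightarrow> (real^'n) \<times> (real^'n) \<Rightarrow> real" where
  "vhder G i j f z = hder G j (pdy i f) z - (\<Sum>r\<in>UNIV. pdy r f z * conn2 G r i j z)"

definition vhder0 ::
  "((real^'n) \<times> (real^'n) \<Rightarrow> real^'n) \<Rightarrow> 'n \<Rightarrow> ((real^'n) \<times> (real^'n) \<Rightarrow> real)
     \<Rightarrow> (real^'n) \<times> (real^'n) \<Rightarrow> real" where
  "vhder0 G i f z = (\<Sum>j\<in>UNIV. vhder G i j f z * snd z $ j)"

section \<open>Hamel and Funk functions\<close>

abbreviation tm_image ::
  "('m, 'e::euclidean_space) chart set \<Rightarrow> ('m, 'e) chart \<Rightarrow> ('m, 'e) tangent_point set
     \<Rightarrow> ('e \<times> 'e) set" where
  "tm_image A c C \<equiv> chart_image (induced_chart A c) C"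

abbreviation tm_rep ::
  "('m, 'e::euclidean_space) chart set \<Rightarrow> ('m, 'e) chart \<Rightarrow> (('m, 'e) tangent_point \<Rightarrow> real)
     \<Rightarrow> 'e \<times> 'e \<Rightarrow> real" where
  "tm_rep A c f \<equiv> coord_rep (induced_chart A c) f"

definition hamel_function ::
  "('m, real^'n) chart set \<Rightarrow> ('m, real^'n) tangent_point set
     \<Rightarrow> ('m, real^'n) second_order_field \<Rightarrow> (('m, real^'n) tangent_point \<Rightarrow> real) \<Rightarrow> bool" where
  "hamel_function A C S f \<longleftrightarrow>
     smooth_function (induced_chart A ` A) C f \<and> pos_homogeneous C f \<and>
     (\<forall>c\<in>A. \<forall>z\<in>tm_image A c C. \<forall>k.
        hder (spray_coeff A S c) k (tm_rep A c f) z = vhder0 (spray_coeff A S c) k (tm_rep A c f) z)"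

definition funk_function ::
  "('m, real^'n) chart set \<Rightarrow> ('m, real^'n) tangent_point set
     \<Rightarrow> ('m, real^'n) second_order_field \<Rightarrow> (('m, real^'n) tangent_point \<Rightarrow> real) \<Rightarrow> bool" where
  "funk_function A C S f \<longleftrightarrow>
     smooth_function (induced_chart A ` A) C f \<and> pos_homogeneous C f \<and>
     (\<forall>c\<in>A. \<forall>z\<in>tm_image A c C. \<forall>k.
        hder (spray_coeff A S c) k (tm_rep A c f) z = tm_rep A c f z * pdy k (tm_rep A c f) z)"

text \<open>A neighborhood of \<open>0\<close> in the base, for functions given on an open cone region \<open>D\<close> of
  \<open>(x, y)\<close>-space: an open set, closed under scaling of \<open>y\<close>, that contains all of the fiber of
  \<open>D\<close> over \<open>0\<close>. When that fiber consists of only some directions, the range of \<open>x\<close> may shrink as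
  \<open>y\<close> approaches the boundary of the fiber; when it consists of all \<open>y \<noteq> 0\<close>, a fixed
  neighborhood \<open>U\<close> of \<open>0\<close> is required.\<close>

definition conic_nhd_of_zero ::
  "('e::euclidean_space \<times> 'e) set \<Rightarrow> ('e \<times> 'e) set \<Rightarrow> bool" where
  "conic_nhd_of_zero D W \<longleftrightarrow>
     open W \<and> W \<subseteq> D \<and>
     (\<forall>(x, y)\<in>W. \<forall>l>0. (x, l *\<^sub>R y) \<in> W) \<and>
     (\<forall>y. (0, y) \<in> D \<longrightarrow> (0, y) \<in> W) \<and>
     ((\<forall>y. y \<noteq> 0 \<longrightarrow> (0, y) \<in> D) \<longrightarrow> (\<exists>U. open U \<and> 0 \<in> U \<and> U \<times> (- {0}) \<subseteq> W))"

end

theory Submission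
  imports Defs
begin

text \<open>
  Both assertions are local, and in a chart both reduce to one-variable facts about homogeneous
  functions.

  For the first assertion, \<open>PQ\<close> is homogeneous of degree two with vertical derivatives
  \<open>(PQ)\<^sub>.\<^sub>j = Q\<^sub>;\<^sub>j\<close>, so Euler's relation gives \<open>Q\<^sub>;\<^sub>j y\<^sup>j = 2 PQ\<close>. Differentiation in \<open>y\<^sup>k\<close>, together with
  \<open>(Q\<^sub>;\<^sub>j)\<^sub>.\<^sub>k = Q\<^sub>.\<^sub>k\<^sub>;\<^sub>j\<close> (lemma \<open>pdy_hder\<close>), gives \<open>Q\<^sub>;\<^sub>k + Q\<^sub>.\<^sub>k\<^sub>;\<^sub>0 = 2 Q\<^sub>;\<^sub>k\<close>; this is lemma
  \<open>hamel_equation_of_transport\<close>. It relies on the symmetry of second derivatives, lemma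
  \<open>frechet_derivative_commute\<close>.

  For the second assertion, \<open>P\<close> is a Funk function of the zero spray, so it is constant along the
  straight line from \<open>(x, y)\<close> to \<open>(0, y + P(x, y) x)\<close>. Along this line \<open>Q\<close> and \<open>1 + t P\<^sub>.\<^sub>m x\<^sup>m\<close> satisfy
  the same linear differential equation, which yields the formula by uniqueness (lemma
  \<open>funk_transport_formula\<close>). The formula holds at every point for which that line stays in the
  domain. By the tube lemma these points form a conic neighborhood of the fiber over \<open>0\<close> (lemma
  \<open>conic_nhd_backward_domain\<close>).
\<close>

section \<open>Smooth functions and the symmetry of second derivatives\<close>

text \<open>Identities between functions hold on the domain only. Since \<open>Ck_on\<close> refers to the derivative
  of the total function, they may be used for smoothness because the domain is open.\<close>

lemma Ck_on_cong:
  assumes "open D" "\<And>x. x \<in> D \<Longrightarrow> f x = g x"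
  shows "Ck_on k D f \<Longrightarrow> Ck_on k D g"
  using assms(2)
proof (induction k arbitrary: f g)
  case 0
  then show ?case by (auto cong: continuous_on_cong)
next
  case (Suc k)
  have der: "(g has_derivative frechet_derivative f (at x)) (at x)" if "x \<in> D" for x
  proof (rule has_derivative_transform_within_open[OF _ assms(1) that])
    show "(f has_derivative frechet_derivative f (at x)) (at x)"
      using Suc.prems(1) that by (simp add: frechet_derivative_works)
  qed (use Suc.prems(2) in auto)
  have eq: "frechet_derivative g (at x) = frechet_derivative f (at x)" if "x \<in> D" for x
    using frechet_derivative_at[OF der[OF that]] by simp
  have "Ck_on k D (\<lambda>x. frechet_derivative g (at x) v)" for v
    by (rule Suc.IH[of "\<lambda>x. frechet_derivative f (at x) v"]) (use Suc.prems(1) eq in auto)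
  then show ?case using der by (auto simp: differentiable_def)
qed

lemma Ck_on_bounded_linear:
  assumes "open D" "bounded_linear h"
  shows "Ck_on k D f \<Longrightarrow> Ck_on k D (\<lambda>x. h (f x))"
proof (induction k arbitrary: f)
  case 0
  then show ?case
    using assms(2) by (auto intro: bounded_linear.continuous_on)
next
  case (Suc k)
  have der: "((\<lambda>x. h (f x)) has_derivative (\<lambda>v. h (frechet_derivative f (at x) v))) (at x)"
    if "x \<in> D" for x
    by (rule bounded_linear.has_derivative[OF assms(2)])
      (use Suc.prems that in \<open>simp add: frechet_derivative_works\<close>)
  have "Ck_on k D (\<lambda>x. frechet_derivative (\<lambda>x. h (f x)) (at x) v)" for v
  proof (rule Ck_on_cong[OF assms(1)])
    show "Ck_on k D (\<lambda>x. h (frechet_derivative f (at x) v))"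
      using Suc by auto
  qed (use frechet_derivative_at[OF der] in metis)
  then show ?case using der by (auto simp: differentiable_def)
qed

lemma smooth_on_bounded_linear:
  "open D \<Longrightarrow> bounded_linear h \<Longrightarrow> smooth_on D f \<Longrightarrow> smooth_on D (\<lambda>x. h (f x))"
  unfolding smooth_on_def using Ck_on_bounded_linear by blast

lemma smooth_on_imp_differentiable:
  "smooth_on D f \<Longrightarrow> x \<in> D \<Longrightarrow> f differentiable (at x)"
  unfolding smooth_on_def by (metis Ck_on.simps(2))

lemma smooth_on_frechet_derivative:
  "smooth_on D f \<Longrightarrow> smooth_on D (\<lambda>x. frechet_derivative f (at x) v)"
  unfolding smooth_on_def by (metis Ck_on.simps(2))

lemma smooth_on_imp_continuous_on: "smooth_on D f \<Longrightarrow> continuous_on D f"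
  unfolding smooth_on_def by (metis Ck_on.simps(1))

text \<open>Everything below that is proved by calculus in one variable (the mean value theorem, Euler's
  relation, the method of characteristics) restricts a function to a line by this rule.\<close>

lemma frechet_derivative_along_line:
  fixes f :: "'a::real_normed_vector \<Rightarrow> real"
  assumes "f differentiable (at (z + t *\<^sub>R v))"
  shows "((\<lambda>t. f (z + t *\<^sub>R v)) has_real_derivative frechet_derivative f (at (z + t *\<^sub>R v)) v)
    (at t within T)"
proof -
  let ?L = "frechet_derivative f (at (z + t *\<^sub>R v))"
  have L: "(f has_derivative ?L) (at (z + t *\<^sub>R v))"
    using assms by (simp add: frechet_derivative_works)
  have "((\<lambda>t. z + t *\<^sub>R v) has_derivative (\<lambda>h. h *\<^sub>R v)) (at t within T)"
    by (auto intro!: derivative_eq_intros)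
  from has_derivative_compose[OF this L]
  have "((\<lambda>t. f (z + t *\<^sub>R v)) has_derivative (\<lambda>h. ?L (h *\<^sub>R v))) (at t within T)" .
  moreover have "?L (h *\<^sub>R v) = ?L v * h" for h
    using linear_scale[OF has_derivative_linear[OF L]] by simp
  ultimately show ?thesis by (simp add: has_field_derivative_def)
qed

text \<open>The mean value theorem is applied first in the direction \<open>u\<close>, to the difference of \<open>f\<close> along
  two parallel edges, and then to \<open>D\<^sub>u f\<close> in the direction \<open>v\<close>. The left-hand side is symmetric in
  \<open>u\<close> and \<open>v\<close>, so exchanging them evaluates the same number by \<open>D\<^sub>u D\<^sub>v f\<close>.\<close>

lemma second_difference_mean_value:
  fixes f :: "'a::euclidean_space \<Rightarrow> real"
  assumes f: "smooth_on D f" and h: "0 < h"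
    and D: "\<And>a b. a \<in> {0..h} \<Longrightarrow> b \<in> {0..h} \<Longrightarrow> z + a *\<^sub>R u + b *\<^sub>R v \<in> D"
  shows "\<exists>a\<in>{0..h}. \<exists>b\<in>{0..h}.
    f (z + h *\<^sub>R u + h *\<^sub>R v) - f (z + h *\<^sub>R u) - f (z + h *\<^sub>R v) + f z =
    h * h * frechet_derivative (\<lambda>w. frechet_derivative f (at w) u) (at (z + a *\<^sub>R u + b *\<^sub>R v)) v"
proof -
  let ?g = "\<lambda>w. frechet_derivative f (at w) u"
  let ?phi = "\<lambda>a. f (z + h *\<^sub>R v + a *\<^sub>R u) - f (z + a *\<^sub>R u)"
  have phi: "(?phi has_real_derivative ?g (z + h *\<^sub>R v + a *\<^sub>R u) - ?g (z + a *\<^sub>R u)) (at a)"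
    if "0 \<le> a" "a \<le> h" for a
  proof (intro DERIV_diff frechet_derivative_along_line)
    show "f differentiable at (z + h *\<^sub>R v + a *\<^sub>R u)"
      using D[of a h] that h by (auto intro!: smooth_on_imp_differentiable[OF f] simp: algebra_simps)
    show "f differentiable at (z + a *\<^sub>R u)"
      using D[of a 0] that h by (auto intro!: smooth_on_imp_differentiable[OF f])
  qed
  from MVT2[OF h phi] obtain a where a: "0 < a" "a < h"
    "?phi h - ?phi 0 = h * (?g (z + h *\<^sub>R v + a *\<^sub>R u) - ?g (z + a *\<^sub>R u))"
    by auto
  let ?G = "\<lambda>w. frechet_derivative ?g (at w) v"
  have psi: "((\<lambda>b. ?g (z + a *\<^sub>R u + b *\<^sub>R v)) has_real_derivative
      ?G (z + a *\<^sub>R u + b *\<^sub>R v)) (at b)" if "0 \<le> b" "b \<le> h" for b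
    using D[of a b] that a
    by (intro frechet_derivative_along_line
        smooth_on_imp_differentiable[OF smooth_on_frechet_derivative[OF f]]) auto
  from MVT2[OF h psi] obtain b where b: "0 < b" "b < h"
    "?g (z + a *\<^sub>R u + h *\<^sub>R v) - ?g (z + a *\<^sub>R u) = h * ?G (z + a *\<^sub>R u + b *\<^sub>R v)"
    by auto
  have "z + h *\<^sub>R v + a *\<^sub>R u = z + a *\<^sub>R u + h *\<^sub>R v" "z + h *\<^sub>R v + h *\<^sub>R u = z + h *\<^sub>R u + h *\<^sub>R v"
    by (simp_all add: algebra_simps)
  with a(3) b(3) have "f (z + h *\<^sub>R u + h *\<^sub>R v) - f (z + h *\<^sub>R u) - f (z + h *\<^sub>R v) + f z =
    h * h * ?G (z + a *\<^sub>R u + b *\<^sub>R v)" by simp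
  with a b show ?thesis by (intro bexI[of _ a] bexI[of _ b]) auto
qed

text \<open>Both iterated derivatives, taken at suitable points of a small parallelogram at \<open>z\<close>, equal the
  same second difference quotient. Continuity of the second derivatives lets the parallelogram
  shrink to \<open>z\<close>.\<close>

lemma frechet_derivative_commute:
  fixes f :: "'a::euclidean_space \<Rightarrow> real"
  assumes D: "open D" "z \<in> D" and f: "smooth_on D f"
  shows "frechet_derivative (\<lambda>w. frechet_derivative f (at w) u) (at z) v =
         frechet_derivative (\<lambda>w. frechet_derivative f (at w) v) (at z) u"
proof -
  let ?F = "\<lambda>u v w. frechet_derivative (\<lambda>w. frechet_derivative f (at w) u) (at w) v"
  have cont: "continuous (at z) (?F u v)" for u v
    using smooth_on_imp_continuous_on[OF smooth_on_frechet_derivative[OF smooth_on_frechet_derivative[OF f]]] D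
    by (auto simp: continuous_on_eq_continuous_at)
  have "\<bar>?F u v z - ?F v u z\<bar> \<le> e" if "e > 0" for e
  proof -
    obtain d1 where d1: "d1 > 0" "\<And>w. dist w z < d1 \<Longrightarrow> \<bar>?F u v w - ?F u v z\<bar> < e / 2"
      using cont[of u v] \<open>e > 0\<close> unfolding continuous_at_eps_delta dist_real_def
      by (elim allE[of _ "e / 2"]) auto
    obtain d2 where d2: "d2 > 0" "\<And>w. dist w z < d2 \<Longrightarrow> \<bar>?F v u w - ?F v u z\<bar> < e / 2"
      using cont[of v u] \<open>e > 0\<close> unfolding continuous_at_eps_delta dist_real_def
      by (elim allE[of _ "e / 2"]) auto
    obtain d3 where d3: "d3 > 0" "\<And>w. dist w z < d3 \<Longrightarrow> w \<in> D"
      using D unfolding open_dist by blast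
    define d where "d = min d1 (min d2 d3)"
    define h where "h = d / (2 * (norm u + norm v + 1))"
    \<comment> \<open>The parallelogram spanned by \<open>h u\<close> and \<open>h v\<close> at \<open>z\<close> stays within \<open>d / 2\<close> of \<open>z\<close>; the summand 1
        in the denominator covers \<open>u = v = 0\<close>.\<close>
    have dD: "w \<in> D" if "dist w z < d" for w
      using d3(2)[of w] that by (simp add: d_def)
    have dpos: "d > 0" using d1 d2 d3 by (simp add: d_def)
    have N: "norm u + norm v + 1 > 0" by (simp add: add_nonneg_pos)
    have h: "h > 0" using dpos N by (simp add: h_def)
    have near: "dist (z + a *\<^sub>R u + b *\<^sub>R v) z < d" if "a \<in> {0..h}" "b \<in> {0..h}" for a b
    proof -
      have "dist (z + a *\<^sub>R u + b *\<^sub>R v) z \<le> a * norm u + b * norm v"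
        using norm_triangle_ineq[of "a *\<^sub>R u" "b *\<^sub>R v"] that by (simp add: dist_norm add.assoc)
      also have "\<dots> \<le> h * norm u + h * norm v"
        using that by (intro add_mono mult_right_mono) auto
      also have "\<dots> < h * (norm u + norm v + 1)" using h by (simp add: algebra_simps)
      also have "\<dots> = d / 2" using N unfolding h_def by (simp add: field_simps)
      also have "\<dots> < d" using dpos by simp
      finally show ?thesis .
    qed
    have near': "dist (z + a *\<^sub>R v + b *\<^sub>R u) z < d" if "a \<in> {0..h}" "b \<in> {0..h}" for a b
      using near[OF that(2) that(1)] by (simp add: algebra_simps)
    obtain a b where ab: "a \<in> {0..h}" "b \<in> {0..h}"
      "f (z + h *\<^sub>R u + h *\<^sub>R v) - f (z + h *\<^sub>R u) - f (z + h *\<^sub>R v) + f z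
        = h * h * ?F u v (z + a *\<^sub>R u + b *\<^sub>R v)"
      using second_difference_mean_value[OF f h, of z u v] near dD by blast
    obtain a' b' where ab': "a' \<in> {0..h}" "b' \<in> {0..h}"
      "f (z + h *\<^sub>R v + h *\<^sub>R u) - f (z + h *\<^sub>R v) - f (z + h *\<^sub>R u) + f z
        = h * h * ?F v u (z + a' *\<^sub>R v + b' *\<^sub>R u)"
      using second_difference_mean_value[OF f h, of z v u] near' dD by blast
    have "z + h *\<^sub>R v + h *\<^sub>R u = z + h *\<^sub>R u + h *\<^sub>R v" by (simp add: algebra_simps)
    then have "h * h * ?F u v (z + a *\<^sub>R u + b *\<^sub>R v) = h * h * ?F v u (z + a' *\<^sub>R v + b' *\<^sub>R u)"
      using ab(3) ab'(3) by (simp only:)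
    then have "?F u v (z + a *\<^sub>R u + b *\<^sub>R v) = ?F v u (z + a' *\<^sub>R v + b' *\<^sub>R u)"
      using h by simp
    moreover have "\<bar>?F u v (z + a *\<^sub>R u + b *\<^sub>R v) - ?F u v z\<bar> < e / 2"
      using d1(2) near[OF ab(1,2)] by (simp add: d_def)
    moreover have "\<bar>?F v u (z + a' *\<^sub>R v + b' *\<^sub>R u) - ?F v u z\<bar> < e / 2"
      using d2(2) near'[OF ab'(1,2)] by (simp add: d_def)
    ultimately show ?thesis by linarith
  qed
  then have "\<bar>?F u v z - ?F v u z\<bar> \<le> 0" by (rule field_le_epsilon) auto
  then show ?thesis by simp
qed


section \<open>The Hamel equation\<close>

lemma euler_homogeneous:
  fixes f :: "'a::real_normed_vector \<times> 'b::real_normed_vector \<Rightarrow> real"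
  assumes f: "f differentiable (at (x, y))"
    and hom: "\<And>l. l > 0 \<Longrightarrow> f (x, l *\<^sub>R y) = l ^ k * f (x, y)"
  shows "frechet_derivative f (at (x, y)) (0, y) = k * f (x, y)"
proof -
  have "((\<lambda>t. f ((x, 0) + t *\<^sub>R (0, y))) has_real_derivative
      frechet_derivative f (at ((x, 0) + 1 *\<^sub>R (0, y))) (0, y)) (at 1)"
    by (rule frechet_derivative_along_line) (use f in simp)
  then have "((\<lambda>t. f (x, t *\<^sub>R y)) has_real_derivative frechet_derivative f (at (x, y)) (0, y)) (at 1)"
    by simp
  moreover have "((\<lambda>t. f (x, t *\<^sub>R y)) has_real_derivative k * f (x, y)) (at 1)"
  proof (rule has_field_derivative_transform_within_open[where S = "{0<..}"])
    show "((\<lambda>t. t ^ k * f (x, y)) has_real_derivative k * f (x, y)) (at 1)"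
      by (auto intro!: derivative_eq_intros)
  qed (use hom in auto)
  ultimately show ?thesis by (rule DERIV_unique)
qed

lemma frechet_derivative_eq_sum_pdx:
  fixes f :: "(real^'n) \<times> (real^'n) \<Rightarrow> real"
  assumes "f differentiable (at z)"
  shows "frechet_derivative f (at z) (v, 0) = (\<Sum>j\<in>UNIV. pdx j f z * v $ j)"
proof -
  interpret L: linear "frechet_derivative f (at z)"
    using assms by (simp add: linear_frechet_derivative)
  have "(v, 0) = (\<Sum>j\<in>UNIV. v $ j *\<^sub>R (axis j 1, 0 :: real^'n))"
    by (rule prod_eqI)
      (use basis_expansion[of v] in \<open>simp_all add: fst_sum snd_sum scalar_mult_eq_scaleR\<close>)
  then have "frechet_derivative f (at z) (v, 0) =
      (\<Sum>j\<in>UNIV. v $ j *\<^sub>R frechet_derivative f (at z) (axis j 1, 0))"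
    by (simp only: L.sum L.scale)
  then show ?thesis by (simp add: pdx_def mult.commute)
qed

lemma frechet_derivative_eq_sum_pdy:
  fixes f :: "(real^'n) \<times> (real^'n) \<Rightarrow> real"
  assumes "f differentiable (at z)"
  shows "frechet_derivative f (at z) (0, v) = (\<Sum>j\<in>UNIV. pdy j f z * v $ j)"
proof -
  interpret L: linear "frechet_derivative f (at z)"
    using assms by (simp add: linear_frechet_derivative)
  have "(0, v) = (\<Sum>j\<in>UNIV. v $ j *\<^sub>R (0 :: real^'n, axis j 1))"
    by (rule prod_eqI)
      (use basis_expansion[of v] in \<open>simp_all add: fst_sum snd_sum scalar_mult_eq_scaleR\<close>)
  then have "frechet_derivative f (at z) (0, v) =
      (\<Sum>j\<in>UNIV. v $ j *\<^sub>R frechet_derivative f (at z) (0, axis j 1))"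
    by (simp only: L.sum L.scale)
  then show ?thesis by (simp add: pdy_def mult.commute)
qed

lemma smooth_on_pdx: "smooth_on D f \<Longrightarrow> smooth_on D (pdx k f)"
  unfolding pdx_def[abs_def] by (rule smooth_on_frechet_derivative)

lemma smooth_on_pdy: "smooth_on D f \<Longrightarrow> smooth_on D (pdy k f)"
  unfolding pdy_def[abs_def] by (rule smooth_on_frechet_derivative)

text \<open>Differentiating \<open>f\<^sub>;\<^sub>j = \<partial>\<^sub>j f - G\<^sup>r\<^sub>j f\<^sub>.\<^sub>r\<close> in \<open>y\<^sup>k\<close> produces the term \<open>- G\<^sup>r\<^sub>j\<^sub>k f\<^sub>.\<^sub>r\<close>, which is exactly
  the connection term of the covariant derivative. Hence vertical differentiation turns \<open>f\<^sub>;\<^sub>j\<close> into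
  \<open>f\<^sub>.\<^sub>k\<^sub>;\<^sub>j\<close>; the order of differentiation is exchanged both for \<open>f\<close> and for \<open>G\<close>.\<close>

lemma pdy_hder:
  fixes G :: "(real^'n) \<times> (real^'n) \<Rightarrow> real^'n"
  assumes D: "open D" "z \<in> D" and f: "smooth_on D f"
    and G: "\<And>r. smooth_on D (\<lambda>w. G w $ r)"
  shows "hder G j f differentiable (at z)" "pdy k (hder G j f) z = vhder G k j f z"
proof -
  have df: "pdx j f differentiable (at z)" "pdy r f differentiable (at z)"
    "conn1 G r j differentiable (at z)" for r
    unfolding conn1_def
    by (rule smooth_on_imp_differentiable[OF _ D(2)] smooth_on_pdx[OF f] smooth_on_pdy[OF f]
        smooth_on_pdy[OF G])+
  have der: "(hder G j f has_derivative (\<lambda>v. frechet_derivative (pdx j f) (at z) v -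
      (\<Sum>r\<in>UNIV. conn1 G r j z * frechet_derivative (pdy r f) (at z) v +
        frechet_derivative (conn1 G r j) (at z) v * pdy r f z))) (at z)"
    unfolding hder_def[abs_def] using df
    by (intro has_derivative_diff has_derivative_sum has_derivative_mult)
      (simp_all add: frechet_derivative_works)
  show "hder G j f differentiable (at z)" using der by (auto simp: differentiable_def)
  have sym: "pdy k (pdx j f) z = pdx j (pdy k f) z" "pdy k (pdy r f) z = pdy r (pdy k f) z"
    "pdy k (conn1 G r j) z = pdy j (conn1 G r k) z" for r
    unfolding conn1_def pdx_def[abs_def] pdy_def[abs_def]
    by (rule frechet_derivative_commute[OF D f] frechet_derivative_commute[OF D G])+
  have "pdy k (hder G j f) z = pdy k (pdx j f) z -
      (\<Sum>r\<in>UNIV. conn1 G r j z * pdy k (pdy r f) z + pdy k (conn1 G r j) z * pdy r f z)"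
    using fun_cong[OF frechet_derivative_at[OF der], of "(0, axis k 1)"] by (simp add: pdy_def)
  also have "\<dots> = vhder G k j f z"
    unfolding vhder_def hder_def conn2_def sym by (simp add: sum.distrib mult.commute)
  finally show "pdy k (hder G j f) z = vhder G k j f z" .
qed

text \<open>The product \<open>p q\<close> is homogeneous of degree two and its vertical derivatives are the \<open>q\<^sub>;\<^sub>j\<close>, so
  Euler's relation reads \<open>q\<^sub>;\<^sub>j y\<^sup>j = 2 p q\<close>. Differentiating it in \<open>y\<^sup>k\<close> gives
  \<open>q\<^sub>;\<^sub>k + q\<^sub>.\<^sub>k\<^sub>;\<^sub>j y\<^sup>j = 2 (p q)\<^sub>.\<^sub>k = 2 q\<^sub>;\<^sub>k\<close>, which is the Hamel equation.\<close>

lemma hamel_equation_of_transport: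
  fixes p q :: "(real^'n) \<times> (real^'n) \<Rightarrow> real" and G :: "(real^'n) \<times> (real^'n) \<Rightarrow> real^'n"
  assumes D: "open D" and p: "smooth_on D p" and q: "smooth_on D q"
    and G: "\<And>r. smooth_on D (\<lambda>w. G w $ r)"
    and homp: "\<And>x y l. (x, y) \<in> D \<Longrightarrow> l > 0 \<Longrightarrow> p (x, l *\<^sub>R y) = l * p (x, y)"
    and homq: "\<And>x y l. (x, y) \<in> D \<Longrightarrow> l > 0 \<Longrightarrow> q (x, l *\<^sub>R y) = l * q (x, y)"
    and eq: "\<And>z i. z \<in> D \<Longrightarrow> hder G i q z = pdy i (\<lambda>w. p w * q w) z"
    and z: "z \<in> D"
  shows "hder G k q z = vhder0 G k q z"
proof -
  let ?F = "\<lambda>w. p w * q w"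
  have F: "?F differentiable (at w)" if "w \<in> D" for w
    using that p q by (intro differentiable_mult smooth_on_imp_differentiable)
  have euler: "(\<Sum>j\<in>UNIV. hder G j q w * snd w $ j) = 2 * ?F w" if w: "w \<in> D" for w
  proof -
    obtain x y where xy: "w = (x, y)" by fastforce
    have "frechet_derivative ?F (at (x, y)) (0, y) = real 2 * ?F (x, y)"
      using w homp homq F[OF w]
      by (intro euler_homogeneous) (auto simp: xy power2_eq_square)
    then show ?thesis
      using frechet_derivative_eq_sum_pdy[OF F[OF w], of y] w by (simp add: eq xy)
  qed
  have "((\<lambda>w. \<Sum>j\<in>UNIV. hder G j q w * snd w $ j) has_derivative
      (\<lambda>v. \<Sum>j\<in>UNIV. hder G j q z * snd v $ j +
         frechet_derivative (hder G j q) (at z) v * snd z $ j)) (at z)"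
    using pdy_hder(1)[OF D z q G]
    by (intro has_derivative_sum has_derivative_mult
        bounded_linear.has_derivative[OF bounded_linear_vec_nth]
        bounded_linear.has_derivative[OF bounded_linear_snd] has_derivative_ident)
      (simp_all add: frechet_derivative_works)
  moreover have "((\<lambda>w. \<Sum>j\<in>UNIV. hder G j q w * snd w $ j) has_derivative
      (\<lambda>v. 2 * frechet_derivative ?F (at z) v)) (at z)"
  proof (rule has_derivative_transform_within_open[OF _ D z])
    show "((\<lambda>w. 2 * ?F w) has_derivative (\<lambda>v. 2 * frechet_derivative ?F (at z) v)) (at z)"
      using F[OF z] by (intro has_derivative_mult_right) (simp add: frechet_derivative_works)
  qed (use euler in simp)
  ultimately have "(\<lambda>v. \<Sum>j\<in>UNIV. hder G j q z * snd v $ j +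
         frechet_derivative (hder G j q) (at z) v * snd z $ j) =
      (\<lambda>v. 2 * frechet_derivative ?F (at z) v)"
    by (rule has_derivative_unique)
  from fun_cong[OF this, of "(0, axis k 1)"]
  have "(\<Sum>j\<in>UNIV. hder G j q z * axis k 1 $ j +
      pdy k (hder G j q) z * snd z $ j) = 2 * pdy k ?F z"
    by (simp add: pdy_def)
  moreover have "(\<Sum>j\<in>UNIV. hder G j q z * axis k 1 $ j) = hder G k q z"
    by (simp add: axis_def if_distrib cong: if_cong)
  ultimately have "hder G k q z + (\<Sum>j\<in>UNIV. pdy k (hder G j q) z * snd z $ j) = 2 * hder G k q z"
    using z by (simp add: sum.distrib eq)
  then show ?thesis
    unfolding vhder0_def using pdy_hder(2)[OF D z q G] by simp
qed

section \<open>Integration along the characteristics of a Funk function\<close>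

text \<open>The integrating factor \<open>exp (- \<integral> a)\<close> makes \<open>w\<close> constant. The zero may be at either end of the
  interval: below, \<open>p\<close> is followed backward from \<open>t = 1\<close> and \<open>q\<close> forward from \<open>t = 0\<close>.\<close>

lemma linear_ode_unique:
  fixes a w :: "real \<Rightarrow> real"
  assumes a: "continuous_on {0..1} a"
    and w: "\<And>t. t \<in> {0..1} \<Longrightarrow> (w has_real_derivative a t * w t) (at t within {0..1})"
    and t0: "t0 \<in> {0..1}" "w t0 = 0" and t: "t \<in> {0..1}"
  shows "w t = 0"
proof -
  define I where "I t = integral {0..t} a" for t
  have "((\<lambda>t. w t * exp (- I t)) has_real_derivative 0) (at t within {0..1})"
    if t: "t \<in> {0..1}" for t
  proof -
    have "(I has_real_derivative a t) (at t within {0..1})"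
      unfolding I_def using integral_has_real_derivative[OF a t] .
    from DERIV_mult[OF w[OF t] DERIV_chain2[OF DERIV_exp DERIV_minus[OF this]]]
    show ?thesis by (simp add: algebra_simps)
  qed
  then obtain c where "\<forall>t\<in>{0..1}. w t * exp (- I t) = c"
    using has_field_derivative_zero_constant[of "{0..1::real}" "\<lambda>t. w t * exp (- I t)"] by auto
  then have "w t * exp (- I t) = c" "w t0 * exp (- I t0) = c" using t t0(1) by blast+
  then show ?thesis using t0(2) by auto
qed

text \<open>The Funk equation says that \<open>p\<close> is annihilated by the field \<open>\<partial>/\<partial>x - p \<partial>/\<partial>y\<close>, a Burgers-type
  equation whose characteristics are straight lines. With \<open>c = p (x, y)\<close>, the segment
  \<open>\<gamma> t = (t x, y + (1 - t) c x)\<close> joins \<open>(0, y + c x)\<close> to \<open>(x, y)\<close>, and any \<open>f\<close> satisfies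
  \<open>(f \<circ> \<gamma>)' = D\<^sub>x f - c D\<^sub>y f\<close> there, both derivatives being in the direction of \<open>x\<close>. Write \<open>s\<close> for
  the derivative of \<open>p\<close> in the direction \<open>(0, x)\<close>.

  For \<open>p\<close> this gives \<open>(p - c)' = s (p - c)\<close> with value \<open>0\<close> at \<open>t = 1\<close>, so \<open>p = c\<close> on the whole segment.
  The terms with \<open>p - c\<close> therefore vanish in the other two equations: the Funk equation
  differentiated in \<open>y\<close> gives \<open>s' = s\<^sup>2\<close>, and the equation for \<open>q\<close> gives \<open>q' = s q\<close>. From \<open>s' = s\<^sup>2\<close> also
  \<open>1 + t s\<close> solves \<open>u' = s u\<close>, so \<open>q\<close> is \<open>1 + t s\<close> times its value at \<open>t = 0\<close>; evaluate at \<open>t = 1\<close>.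
  Comparing two solutions of a linear equation avoids dividing by \<open>1 + t s\<close>.\<close>

lemma funk_transport_formula:
  fixes p q :: "'e::euclidean_space \<times> 'e \<Rightarrow> real"
  assumes D: "open D" and p: "smooth_on D p" and q: "smooth_on D q"
    and funk: "\<And>z v. z \<in> D \<Longrightarrow>
      frechet_derivative p (at z) (v, 0) = p z * frechet_derivative p (at z) (0, v)"
    and transport: "\<And>z v. z \<in> D \<Longrightarrow>
      frechet_derivative q (at z) (v, 0) = frechet_derivative (\<lambda>w. p w * q w) (at z) (0, v)"
    and segment: "\<And>t. t \<in> {0..1} \<Longrightarrow> (t *\<^sub>R x, y + ((1 - t) * p (x, y)) *\<^sub>R x) \<in> D"
  shows "q (x, y) = q (0, y + p (x, y) *\<^sub>R x) * (1 + frechet_derivative p (at (x, y)) (0, x))"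
proof -
  define c where "c = p (x, y)"
  define \<gamma> where "\<gamma> t = (0, y + c *\<^sub>R x) + t *\<^sub>R (x, - c *\<^sub>R x)" for t
  let ?T = "{0..1::real}"
  let ?s = "\<lambda>z. frechet_derivative p (at z) (0, x)"
  have \<gamma>D: "\<gamma> t \<in> D" if "t \<in> ?T" for t
    using segment[OF that] by (simp add: \<gamma>_def c_def algebra_simps)
  have \<gamma>1: "\<gamma> 1 = (x, y)" and \<gamma>0: "\<gamma> 0 = (0, y + c *\<^sub>R x)" by (simp_all add: \<gamma>_def)
  have cont\<gamma>: "continuous_on ?T \<gamma>" unfolding \<gamma>_def by (intro continuous_intros)
  have smooth_s: "smooth_on D ?s" by (rule smooth_on_frechet_derivative[OF p])
  have cont_s: "continuous_on ?T (\<lambda>t. ?s (\<gamma> t))"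
    by (rule continuous_on_compose2[OF smooth_on_imp_continuous_on[OF smooth_s] cont\<gamma>])
      (use \<gamma>D in auto)
  have along: "((\<lambda>t. f (\<gamma> t)) has_real_derivative
      frechet_derivative f (at (\<gamma> t)) (x, 0) - c * frechet_derivative f (at (\<gamma> t)) (0, x))
      (at t within ?T)" if f: "smooth_on D f" and t: "t \<in> ?T" for f t
  proof -
    have df: "f differentiable (at (\<gamma> t))" by (rule smooth_on_imp_differentiable[OF f \<gamma>D[OF t]])
    interpret L: linear "frechet_derivative f (at (\<gamma> t))"
      using df by (rule linear_frechet_derivative)
    have "(x, - c *\<^sub>R x) = (x, 0) - c *\<^sub>R (0, x)" by simp
    then have "frechet_derivative f (at (\<gamma> t)) (x, - c *\<^sub>R x) =
        frechet_derivative f (at (\<gamma> t)) (x, 0) - c * frechet_derivative f (at (\<gamma> t)) (0, x)"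
      by (simp only: L.diff L.scale) simp
    with frechet_derivative_along_line[OF df[unfolded \<gamma>_def]] show ?thesis
      by (simp add: \<gamma>_def)
  qed
  have pc: "p (\<gamma> t) = c" if t: "t \<in> ?T" for t
  proof -
    have "p (\<gamma> t) - c = 0"
    proof (rule linear_ode_unique[OF cont_s _ _ _ t,
        where w = "\<lambda>t. p (\<gamma> t) - c" and ?t0.0 = 1])
      show "((\<lambda>t. p (\<gamma> t) - c) has_real_derivative ?s (\<gamma> t) * (p (\<gamma> t) - c)) (at t within ?T)"
        if "t \<in> ?T" for t
        using DERIV_diff[OF along[OF p that] DERIV_const[of c]] funk[OF \<gamma>D[OF that], of x]
        by (simp add: algebra_simps)
    qed (simp_all add: \<gamma>1 c_def)
    then show ?thesis by simp
  qed
  have dp: "p differentiable (at z)" and dq: "q differentiable (at z)"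
    and ds: "?s differentiable (at z)" if "z \<in> D" for z
    using that p q smooth_s by (auto intro: smooth_on_imp_differentiable)
  have prod: "frechet_derivative (\<lambda>w. f w * g w) (at z) v =
      f z * frechet_derivative g (at z) v + frechet_derivative f (at z) v * g z"
    if "f differentiable (at z)" "g differentiable (at z)" for f g :: "'e \<times> 'e \<Rightarrow> real" and z v
    by (rule fun_cong[OF frechet_derivative_at[OF has_derivative_mult], symmetric])
      (use that in \<open>simp_all add: frechet_derivative_works\<close>)
  have s': "((\<lambda>t. ?s (\<gamma> t)) has_real_derivative ?s (\<gamma> t) * ?s (\<gamma> t)) (at t within ?T)"
    if t: "t \<in> ?T" for t
  proof -
    let ?z = "\<gamma> t"
    have z: "?z \<in> D" by (rule \<gamma>D[OF t])
    have "frechet_derivative ?s (at ?z) (x, 0) =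
        frechet_derivative (\<lambda>w. frechet_derivative p (at w) (x, 0)) (at ?z) (0, x)"
      by (rule frechet_derivative_commute[OF D z p])
    also have "\<dots> = frechet_derivative (\<lambda>w. p w * ?s w) (at ?z) (0, x)"
      by (rule fun_cong[OF frechet_derivative_transform_within_open[OF _ D z]])
        (use funk smooth_on_imp_differentiable[OF smooth_on_frechet_derivative[OF p] z] in auto)
    also have "\<dots> = c * frechet_derivative ?s (at ?z) (0, x) + ?s ?z * ?s ?z"
      by (simp add: prod[OF dp[OF z] ds[OF z]] pc[OF t])
    finally show ?thesis using along[OF smooth_s t] by simp
  qed
  have q': "((\<lambda>t. q (\<gamma> t)) has_real_derivative ?s (\<gamma> t) * q (\<gamma> t)) (at t within ?T)"
    if t: "t \<in> ?T" for t
    using along[OF q t] transport[OF \<gamma>D[OF t], of x]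
    by (simp add: prod[OF dp[OF \<gamma>D[OF t]] dq[OF \<gamma>D[OF t]]] pc[OF t])
  have "q (\<gamma> 1) - q (\<gamma> 0) * (1 + 1 * ?s (\<gamma> 1)) = 0"
  proof (rule linear_ode_unique[OF cont_s,
        where w = "\<lambda>t. q (\<gamma> t) - q (\<gamma> 0) * (1 + t * ?s (\<gamma> t))" and ?t0.0 = 0])
    fix t assume t: "t \<in> ?T"
    show "((\<lambda>t. q (\<gamma> t) - q (\<gamma> 0) * (1 + t * ?s (\<gamma> t))) has_real_derivative
        ?s (\<gamma> t) * (q (\<gamma> t) - q (\<gamma> 0) * (1 + t * ?s (\<gamma> t)))) (at t within ?T)"
      by (rule derivative_eq_intros q'[OF t] s'[OF t] refl)+ (simp add: algebra_simps)
  qed simp_all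
  then show ?thesis by (simp add: \<gamma>0 \<gamma>1 c_def)
qed

text \<open>The points from which the characteristic, followed back to the fiber over \<open>0\<close>, stays in \<open>D\<close>.\<close>

definition backward_domain ::
  "('e::euclidean_space \<times> 'e) set \<Rightarrow> ('e \<times> 'e \<Rightarrow> real) \<Rightarrow> ('e \<times> 'e) set" where
  "backward_domain D p = {(x, y) \<in> D.
     \<forall>t\<in>{0..1}. (t *\<^sub>R x, y + ((1 - t) * p (x, y)) *\<^sub>R x) \<in> D}"

text \<open>The points of a characteristic depend continuously on \<open>(x, y)\<close> and on \<open>t\<close>, and \<open>t\<close> ranges over a compact
  interval, so a whole segment in \<open>D\<close> stays in \<open>D\<close> under small perturbations (tube lemma).\<close>

lemma open_backward_domain:
  assumes D: "open D" and p: "continuous_on D p"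
  shows "open (backward_domain D p)"
proof (subst open_subopen, intro ballI)
  fix z assume z: "z \<in> backward_domain D p"
  let ?\<Psi> = "\<lambda>(z, t). (t *\<^sub>R fst z, snd z + ((1 - t) * p z) *\<^sub>R fst z)"
  let ?O = "(D \<times> UNIV) \<inter> ?\<Psi> -` D"
  have "continuous_on (D \<times> UNIV) ?\<Psi>"
    unfolding split_beta
    by (intro continuous_intros continuous_on_compose2[OF p]) auto
  then have O: "open ?O"
    by (rule continuous_open_preimage) (simp_all add: open_Times D)
  have "{z} \<times> {0..1} \<subseteq> ?O" using z by (auto simp: backward_domain_def)
  from Elementary_Topology.tube_lemma[OF compact_Icc O this] obtain Z
    where "z \<in> Z" "open Z" "Z \<times> {0..1} \<subseteq> ?O" by auto
  moreover from this have "Z \<subseteq> backward_domain D p"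
    by (fastforce simp: backward_domain_def subset_iff)
  ultimately show "\<exists>T. open T \<and> z \<in> T \<and> T \<subseteq> backward_domain D p" by blast
qed

text \<open>Homogeneity of \<open>p\<close> makes the characteristics of \<open>(x, l y)\<close> the rescaled ones of \<open>(x, y)\<close>, and over
  \<open>x = 0\<close> they are constant. If every \<open>y \<noteq> 0\<close> occurs over \<open>0\<close>, compactness of the unit sphere gives
  one neighborhood of \<open>0\<close> for all unit \<open>y\<close>, and scaling extends it to all nonzero \<open>y\<close>.\<close>

lemma conic_nhd_backward_domain:
  assumes D: "open D" and p: "continuous_on D p"
    and cone: "\<And>x y l. (x, y) \<in> D \<Longrightarrow> l > 0 \<Longrightarrow> (x, l *\<^sub>R y) \<in> D"
    and hom: "\<And>x y l. (x, y) \<in> D \<Longrightarrow> l > 0 \<Longrightarrow> p (x, l *\<^sub>R y) = l * p (x, y)"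
  shows "conic_nhd_of_zero D (backward_domain D p)"
proof -
  let ?W = "backward_domain D p"
  have W: "open ?W" by (rule open_backward_domain[OF D p])
  have scale: "(x, l *\<^sub>R y) \<in> ?W" if xy: "(x, y) \<in> ?W" and l: "l > 0" for x y l
  proof -
    have xyD: "(x, y) \<in> D" using xy by (simp add: backward_domain_def)
    have "(t *\<^sub>R x, l *\<^sub>R y + ((1 - t) * p (x, l *\<^sub>R y)) *\<^sub>R x) \<in> D" if "t \<in> {0..1}" for t
    proof -
      have "(t *\<^sub>R x, l *\<^sub>R (y + ((1 - t) * p (x, y)) *\<^sub>R x)) \<in> D"
        by (rule cone) (use xy that l in \<open>auto simp: backward_domain_def\<close>)
      then show ?thesis by (simp add: hom[OF xyD l] algebra_simps)
    qed
    then show ?thesis using cone[OF xyD l] by (simp add: backward_domain_def)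
  qed
  have zero: "(0, y) \<in> ?W" if "(0, y) \<in> D" for y
    using that by (simp add: backward_domain_def)
  have "\<exists>U. open U \<and> 0 \<in> U \<and> U \<times> (- {0}) \<subseteq> ?W" if all: "\<forall>y. y \<noteq> 0 \<longrightarrow> (0, y) \<in> D"
  proof -
    have "(0, y) \<in> ?W" if "norm y = 1" for y
    proof -
      have "y \<noteq> 0" using that by auto
      with all zero show ?thesis by blast
    qed
    then have "{0} \<times> sphere 0 1 \<subseteq> ?W" by auto
    from Elementary_Topology.tube_lemma[OF compact_sphere W this] obtain U
      where U: "0 \<in> U" "open U" "U \<times> sphere 0 1 \<subseteq> ?W" by auto
    have "(x, y) \<in> ?W" if "x \<in> U" "y \<noteq> 0" for x y
    proof -
      have "(x, (1 / norm y) *\<^sub>R y) \<in> ?W" using U that by auto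
      from scale[OF this, of "norm y"] that show ?thesis by simp
    qed
    with U show ?thesis by (intro exI[of _ U]) auto
  qed
  with W scale zero show ?thesis
    unfolding conic_nhd_of_zero_def by (auto simp: backward_domain_def)
qed

section \<open>Representation in the charts of the manifold\<close>

text \<open>The representation of a function in a chart goes through \<open>inv_into\<close>, which is a true inverse only
  because of this injectivity: a tangent vector is determined by its component in one chart
  around its base point.\<close>

lemma inj_on_induced_chart:
  assumes M: "smooth_manifold X A" and c: "c \<in> A"
  shows "inj_on (snd (induced_chart A c)) (fst (induced_chart A c))"
proof (rule inj_onI)
  fix z w assume z: "z \<in> fst (induced_chart A c)" and w: "w \<in> fst (induced_chart A c)"
    and eq: "snd (induced_chart A c) z = snd (induced_chart A c) w"
  obtain a u b v where zw: "z = (a, u)" "w = (b, v)" by fastforce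
  have a: "a \<in> fst c" "u \<in> tangent_space A a" and b: "b \<in> fst c" "v \<in> tangent_space A b"
    and "snd c a = snd c b" and uv: "u c = v c"
    using z w eq by (auto simp: zw induced_chart_def tangent_bundle_def)
  have "openin X (fst c)"
    "homeomorphic_map (subtopology X (fst c)) (top_of_set (snd c ` fst c)) (snd c)"
    using M c by (auto simp: smooth_manifold_def)
  then have "inj_on (snd c) (fst c)"
    using homeomorphic_imp_injective_map openin_subset by (fastforce simp: Int_absorb1)
  then have ab: "a = b" using a b \<open>snd c a = snd c b\<close> by (auto dest: inj_onD)
  have "u d = v d" for d
  proof (cases "d \<in> A \<and> b \<in> fst d")
    case True
    have "w d = frechet_derivative (transition c d) (at (snd c b)) (w c)"
      if "w \<in> tangent_space A b" for w
      using that True b(1) c unfolding tangent_space_def by blast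
    from this[OF a(2)[unfolded ab]] this[OF b(2)] show ?thesis by (simp only: uv)
  next
    case False
    then have "w d = 0" if "w \<in> tangent_space A b" for w
      using that unfolding tangent_space_def by blast
    from this[OF a(2)[unfolded ab]] this[OF b(2)] show ?thesis by (simp only:)
  qed
  then show "z = w" using ab by (simp add: zw fun_eq_iff)
qed

text \<open>Fiberwise scaling commutes with the induced chart, so the cone structure and homogeneity pass
  from the tangent bundle to coordinates.\<close>

lemma tm_image_scale:
  assumes M: "smooth_manifold X A" and C: "conical_region A C" and c: "c \<in> A"
    and xy: "(x, y) \<in> tm_image A c C" and l: "l > 0"
  shows "(x, l *\<^sub>R y) \<in> tm_image A c C"
    and "pos_homogeneous C f \<Longrightarrow> tm_rep A c f (x, l *\<^sub>R y) = l * tm_rep A c f (x, y)"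
proof -
  let ?c = "induced_chart A c"
  have C_sub: "C \<subseteq> tangent_bundle A"
    using C by (auto simp: conical_region_def slit_tangent_bundle_def)
  obtain z where z: "z \<in> C" "z \<in> fst ?c" "(x, y) = snd ?c z"
    using xy by (auto simp: chart_image_def)
  have lz: "scale_tangent l z \<in> C" using C z l by (auto simp: conical_region_def)
  have lz': "scale_tangent l z \<in> fst ?c" "snd ?c (scale_tangent l z) = (x, l *\<^sub>R y)"
    using z lz C_sub by (auto simp: induced_chart_def scale_tangent_def)
  show "(x, l *\<^sub>R y) \<in> tm_image A c C"
    using lz lz' by (force simp: chart_image_def)
  have rep: "tm_rep A c f (snd ?c w) = f w" if "w \<in> fst ?c" for w
    using inj_on_induced_chart[OF M c] that by (simp add: coord_rep_def)
  show "tm_rep A c f (x, l *\<^sub>R y) = l * tm_rep A c f (x, y)" if "pos_homogeneous C f"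
    using rep[OF lz'(1)] rep[OF z(2)] that z l lz'(2) by (simp add: pos_homogeneous_def)
qed

lemma smooth_on_spray_coeff:
  fixes A :: "('m, real^'n) chart set"
  assumes S: "spray A C S" and c: "c \<in> A"
  shows "smooth_on (tm_image A c C) (\<lambda>z. spray_coeff A S c z $ r)"
proof -
  let ?c = "induced_chart A c"
  have S_smooth: "smooth_on (tm_image A c C) (coord_rep ?c (\<lambda>z. S z ?c))"
    using S c unfolding spray_def smooth_vector_field_def by blast
  have linear: "bounded_linear (\<lambda>w :: (real^'n) \<times> (real^'n). ((- 1 / 2) *\<^sub>R snd w) $ r)"
    by (rule bounded_linear_compose[OF bounded_linear_vec_nth
        bounded_linear_compose[OF bounded_linear_scaleR_right bounded_linear_snd]])
  have "open (tm_image A c C)"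
    using S c unfolding spray_def conical_region_def by blast
  from smooth_on_bounded_linear[OF this linear S_smooth] show ?thesis
    by (simp add: spray_coeff_def coord_rep_def comp_def)
qed

lemma hder_eq_pdx_of_zero_spray:
  assumes D: "open D" "z \<in> D" and G: "\<And>w. w \<in> D \<Longrightarrow> G w = 0"
  shows "hder G k f z = pdx k f z"
proof -
  have "((\<lambda>w. G w $ r) has_derivative (\<lambda>_. 0)) (at z)" for r
    by (rule has_derivative_transform_within_open[OF has_derivative_const[of 0] D]) (simp add: G)
  then have "conn1 G r k z = 0" for r
    unfolding conn1_def pdy_def by (metis frechet_derivative_at)
  then show ?thesis by (simp add: hder_def)
qed

theorem lemma3p9:
  fixes X :: "'m topology"
    and A :: "('m, real^'n) chart set"
    and C :: "('m, real^'n) tangent_point set"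
    and S :: "('m, real^'n) second_order_field"
    and P Q :: "('m, real^'n) tangent_point \<Rightarrow> real"
  assumes "smooth_manifold X A"
    and "spray A C S"
    and "smooth_function (induced_chart A ` A) C P" and "pos_homogeneous C P"
    and "smooth_function (induced_chart A ` A) C Q" and "pos_homogeneous C Q"
    and "\<forall>c\<in>A. \<forall>z\<in>tm_image A c C. \<forall>i.
           hder (spray_coeff A S c) i (tm_rep A c Q) z =
           pdy i (\<lambda>w. tm_rep A c P w * tm_rep A c Q w) z"
  shows "hamel_function A C S Q \<and>
    \<comment> \<open>the manifold is \<open>\<real>\<^sup>n\<close>, with global coordinates \<open>c\<close> in which the spray vanishes\<close>
    (\<forall>c\<in>A. fst c = topspace X \<and> snd c ` fst c = UNIV \<and>
        (\<forall>z\<in>tm_image A c C. spray_coeff A S c z = 0) \<and>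
        funk_function A C S P \<longrightarrow>
      (let p = tm_rep A c P; q = tm_rep A c Q; \<psi> = (\<lambda>y. q (0, y)) in
        \<exists>W. conic_nhd_of_zero (tm_image A c C) W \<and>
          (\<forall>(x, y)\<in>W.
             (0, y + p (x, y) *\<^sub>R x) \<in> tm_image A c C \<and>
             q (x, y) = \<psi> (y + p (x, y) *\<^sub>R x) * (1 + (\<Sum>m\<in>UNIV. pdy m p (x, y) * x $ m)))))"
proof (intro conjI ballI impI)
  have C: "conical_region A C" using assms(2) unfolding spray_def by blast
  have D: "open (tm_image A c C)" if "c \<in> A" for c
    using C that by (simp add: conical_region_def)
  have smooth: "smooth_on (tm_image A c C) (tm_rep A c P)" "smooth_on (tm_image A c C) (tm_rep A c Q)"
    if "c \<in> A" for c
    using assms(3,5) that by (simp_all add: smooth_function_def)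
  show "hamel_function A C S Q"
    unfolding hamel_function_def
  proof (intro conjI ballI allI)
    fix c z k assume c: "c \<in> A" and z: "z \<in> tm_image A c C"
    show "hder (spray_coeff A S c) k (tm_rep A c Q) z = vhder0 (spray_coeff A S c) k (tm_rep A c Q) z"
      by (rule hamel_equation_of_transport[OF D[OF c] smooth[OF c]
            smooth_on_spray_coeff[OF assms(2) c] _ _ _ z])
        (use tm_image_scale(2)[OF assms(1) C c] assms(4,6,7) c in auto)
  qed (fact assms(5,6))+
next
  fix c assume c: "c \<in> A"
    and flat: "fst c = topspace X \<and> snd c ` fst c = UNIV \<and>
      (\<forall>z\<in>tm_image A c C. spray_coeff A S c z = 0) \<and> funk_function A C S P"
  define D p q where "D = tm_image A c C" and "p = tm_rep A c P" and "q = tm_rep A c Q"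
  have C: "conical_region A C" using assms(2) unfolding spray_def by blast
  have D: "open D" using C c by (simp add: conical_region_def D_def)
  have p: "smooth_on D p" and q: "smooth_on D q"
    using assms(3,5) c by (simp_all add: smooth_function_def D_def p_def q_def)
  have pdx: "hder (spray_coeff A S c) k f z = pdx k f z" if "z \<in> D" for k f z
    by (rule hder_eq_pdx_of_zero_spray[OF D that]) (use flat in \<open>auto simp: D_def\<close>)
  have px: "pdx k p z = p z * pdy k p z" if "z \<in> D" for k z
    using flat c that pdx[OF that, of k p] by (simp add: funk_function_def D_def p_def)
  have qx: "pdx k q z = pdy k (\<lambda>w. p w * q w) z" if "z \<in> D" for k z
    using assms(7) c that pdx[OF that, of k q] by (simp add: D_def p_def q_def)
  have dp: "p differentiable (at z)" and dq: "q differentiable (at z)" if "z \<in> D" for z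
    using that p q by (auto intro: smooth_on_imp_differentiable)
  have funk: "frechet_derivative p (at z) (v, 0) = p z * frechet_derivative p (at z) (0, v)"
    if "z \<in> D" for z v
    using that by (simp add: frechet_derivative_eq_sum_pdx frechet_derivative_eq_sum_pdy dp px
        sum_distrib_left mult.assoc)
  have transport: "frechet_derivative q (at z) (v, 0) = frechet_derivative (\<lambda>w. p w * q w) (at z) (0, v)"
    if "z \<in> D" for z v
    using that by (simp add: frechet_derivative_eq_sum_pdx frechet_derivative_eq_sum_pdy dp dq qx)
  have "conic_nhd_of_zero D (backward_domain D p)"
    by (rule conic_nhd_backward_domain[OF D smooth_on_imp_continuous_on[OF p]])
      (use tm_image_scale[OF assms(1) C c] assms(4) in \<open>auto simp: D_def p_def\<close>)
  moreover have "(0, y + p (x, y) *\<^sub>R x) \<in> D \<and>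
      q (x, y) = q (0, y + p (x, y) *\<^sub>R x) * (1 + (\<Sum>m\<in>UNIV. pdy m p (x, y) * x $ m))"
    if xy: "(x, y) \<in> backward_domain D p" for x y
  proof
    have segment: "(t *\<^sub>R x, y + ((1 - t) * p (x, y)) *\<^sub>R x) \<in> D" if "t \<in> {0..1}" for t
      using xy that by (simp add: backward_domain_def)
    from segment[of 0] show "(0, y + p (x, y) *\<^sub>R x) \<in> D" by simp
    have "(x, y) \<in> D" using xy by (simp add: backward_domain_def)
    then show "q (x, y) = q (0, y + p (x, y) *\<^sub>R x) * (1 + (\<Sum>m\<in>UNIV. pdy m p (x, y) * x $ m))"
      using funk_transport_formula[OF D p q funk transport segment]
      by (simp add: frechet_derivative_eq_sum_pdy dp)
  qed
  ultimately show "let p = tm_rep A c P; q = tm_rep A c Q; \<psi> = (\<lambda>y. q (0, y)) in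
        \<exists>W. conic_nhd_of_zero (tm_image A c C) W \<and>
          (\<forall>(x, y)\<in>W.
             (0, y + p (x, y) *\<^sub>R x) \<in> tm_image A c C \<and>
             q (x, y) = \<psi> (y + p (x, y) *\<^sub>R x) * (1 + (\<Sum>m\<in>UNIV. pdy m p (x, y) * x $ m)))"
    unfolding Let_def D_def p_def q_def by blast
qed

end
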